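(* Let $X$ be a convex cone in a real vector space and let $\succcurlyeq$ be an additive binary relation on $X$ with asymmetric part $\succ$. Then: (a) $\succcurlyeq$ is upper mixture-continuous if and only if it is lower mixture-continuous if and only if it is mixture-continuous; (b) $\succ$ is upper strict-Archimedean if and only if it is lower strict-Archimedean if and only if it is strict-Archimedean.
   Context: A convex cone is a subset $X$ of a vector space such that $\alpha x+\beta y\in X$ for all scalars $\alpha,\beta>0$ and all $x,y\in X$. A binary relation $\succcurlyeq$ on $X$ is additive if for all $x,y,z\in X$: $x\succcurlyeq y$ if and only if $x+z\succcurlyeq y+z$. No other property of $\succcurlyeq$ is assumed. $x\succ y$ iff $x\succcurlyeq y$ and not $y\succcurlyeq x$; $x\preccurlyeq y$ iff $y\succcurlyeq x$; $x\prec y$ iff $y\succ x$. For $\lambda\in[0,1]$, $x\lambda y=\lambda x+(1-\lambda)y$. Upper (lower) mixture-continuous: for all $x,y,z\in X$ the set $\{\lambda\in[0,1]:x\lambda y\succcurlyeq z\}$ (resp. $\{\lambda\in[0,1]:x\lambda y\preccurlyeq z\}$) is closed. Mixture-continuous: both. Upper (lower) strict-Archimedean: for all $x,y,z\in X$ the set $\{\lambda\in[0,1]:x\lambda y\succ z\}$ (resp. $\{\lambda\in[0,1]:x\lambda y\prec z\}$) is open in $[0,1]$. Strict-Archimedean: both. *)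

theory Defs
  imports "HOL-Analysis.Analysis"
begin

(* Only strictly positive scalars are allowed here, so a cone need not contain 0 and may be
   empty. The library's convex_cone is strictly stronger: it forces 0 to be a member. *)
definition positive_convex_cone :: "'a::real_vector set \<Rightarrow> bool" where
  "positive_convex_cone X \<longleftrightarrow>
     (\<forall>x\<in>X. \<forall>y\<in>X. \<forall>\<alpha> \<beta>. \<alpha> > 0 \<longrightarrow> \<beta> > 0 \<longrightarrow> \<alpha> *\<^sub>R x + \<beta> *\<^sub>R y \<in> X)"

(* A binary relation on X is a predicate R on the ambient type; R x y reads "x is weakly
   preferred to y". Every notion below depends only on the values of R on X. *)
definition additive_on :: "'a::real_vector set \<Rightarrow> ('a \<Rightarrow> 'a \<Rightarrow> bool) \<Rightarrow> bool" where
  "additive_on X R \<longleftrightarrow> (\<forall>x\<in>X. \<forall>y\<in>X. \<forall>z\<in>X. R x y \<longleftrightarrow> R (x + z) (y + z))"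

definition asymmetric_part :: "('a \<Rightarrow> 'a \<Rightarrow> bool) \<Rightarrow> 'a \<Rightarrow> 'a \<Rightarrow> bool" where
  "asymmetric_part R x y \<longleftrightarrow> R x y \<and> \<not> R y x"

definition mixture :: "'a::real_vector \<Rightarrow> real \<Rightarrow> 'a \<Rightarrow> 'a" where
  "mixture x t y = t *\<^sub>R x + (1 - t) *\<^sub>R y"

definition upper_mixture_continuous :: "'a::real_vector set \<Rightarrow> ('a \<Rightarrow> 'a \<Rightarrow> bool) \<Rightarrow> bool" where
  "upper_mixture_continuous X R \<longleftrightarrow>
     (\<forall>x\<in>X. \<forall>y\<in>X. \<forall>z\<in>X. closed {t\<in>{0..1}. R (mixture x t y) z})"

definition lower_mixture_continuous :: "'a::real_vector set \<Rightarrow> ('a \<Rightarrow> 'a \<Rightarrow> bool) \<Rightarrow> bool" where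
  "lower_mixture_continuous X R \<longleftrightarrow>
     (\<forall>x\<in>X. \<forall>y\<in>X. \<forall>z\<in>X. closed {t\<in>{0..1}. R z (mixture x t y)})"

definition mixture_continuous :: "'a::real_vector set \<Rightarrow> ('a \<Rightarrow> 'a \<Rightarrow> bool) \<Rightarrow> bool" where
  "mixture_continuous X R \<longleftrightarrow> upper_mixture_continuous X R \<and> lower_mixture_continuous X R"

(* The three strict-Archimedean notions take the strict relation S itself as argument. *)
definition upper_strict_archimedean :: "'a::real_vector set \<Rightarrow> ('a \<Rightarrow> 'a \<Rightarrow> bool) \<Rightarrow> bool" where
  "upper_strict_archimedean X S \<longleftrightarrow>
     (\<forall>x\<in>X. \<forall>y\<in>X. \<forall>z\<in>X.
        openin (top_of_set {0..1}) {t\<in>{0..1}. S (mixture x t y) z})"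

definition lower_strict_archimedean :: "'a::real_vector set \<Rightarrow> ('a \<Rightarrow> 'a \<Rightarrow> bool) \<Rightarrow> bool" where
  "lower_strict_archimedean X S \<longleftrightarrow>
     (\<forall>x\<in>X. \<forall>y\<in>X. \<forall>z\<in>X.
        openin (top_of_set {0..1}) {t\<in>{0..1}. S z (mixture x t y)})"

definition strict_archimedean :: "'a::real_vector set \<Rightarrow> ('a \<Rightarrow> 'a \<Rightarrow> bool) \<Rightarrow> bool" where
  "strict_archimedean X S \<longleftrightarrow> upper_strict_archimedean X S \<and> lower_strict_archimedean X S"

end

theory Submission
  imports Defs
begin

text \<open>
  The mixtures \<open>t x + (1 - t) y\<close> and \<open>t y + (1 - t) x\<close> sum to \<open>x + y\<close>. Adding the second one to
  both sides of a comparison of \<open>z\<close> with the first moves the mixture to the other side, so every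
  lower section is an upper section for the points \<open>y + z\<close>, \<open>x + z\<close>, \<open>x + y\<close>, and vice versa. This
  uses only additivity, which the asymmetric part inherits.
\<close>

lemma positive_convex_cone_add:
  assumes "positive_convex_cone X" "x \<in> X" "y \<in> X"
  shows "x + y \<in> X"
  using assms unfolding positive_convex_cone_def
  by (metis scaleR_one zero_less_one)

lemma positive_convex_cone_mixture:
  assumes "positive_convex_cone X" "x \<in> X" "y \<in> X" "t \<in> {0..1}"
  shows "mixture x t y \<in> X"
\<comment> \<open>The cone condition speaks only of positive coefficients. At the endpoints one
  coefficient vanishes, but there the mixture is \<open>y\<close> or \<open>x\<close>
  itself.\<close>
proof (cases "t = 0 \<or> t = 1")
  case True
  then show ?thesis using assms by (auto simp: mixture_def)
next
  case False
  then show ?thesis using assms by (simp add: mixture_def positive_convex_cone_def)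
qed

lemma additive_on_converse: "additive_on X R \<Longrightarrow> additive_on X R\<inverse>\<inverse>"
  by (simp add: additive_on_def)

lemma additive_on_asymmetric_part: "additive_on X R \<Longrightarrow> additive_on X (asymmetric_part R)"
  unfolding additive_on_def asymmetric_part_def by blast

lemma mixture_add_swap: "mixture x t y + mixture y t x = x + y"
  by (simp add: mixture_def algebra_simps)

text \<open>Splitting \<open>z\<close> as \<open>t z + (1 - t) z\<close> lets each part be absorbed
  by one end of the mixture.\<close>

lemma mixture_translate: "z + mixture y t x = mixture (y + z) t (x + z)"
  by (simp add: mixture_def algebra_simps)

lemma additive_on_mixture_swap:
  assumes "positive_convex_cone X" "additive_on X S"
    and "x \<in> X" "y \<in> X" "z \<in> X" "t \<in> {0..1}"
  shows "S z (mixture x t y) \<longleftrightarrow> S (mixture (y + z) t (x + z)) (x + y)"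
proof -
  have "S z (mixture x t y) \<longleftrightarrow> S (z + mixture y t x) (mixture x t y + mixture y t x)"
    using assms positive_convex_cone_mixture unfolding additive_on_def by blast
  then show ?thesis
    unfolding mixture_add_swap by (simp only: mixture_translate)
qed

text \<open>The two families of sections consist of the same sets, so they agree on any property of
  sets whatever. Keeping \<open>P\<close> arbitrary lets one statement serve both closedness and
  openness relative to the unit interval.\<close>

lemma upper_sections_iff_lower_sections:
  assumes cone: "positive_convex_cone X" and add: "additive_on X S"
  shows "(\<forall>x\<in>X. \<forall>y\<in>X. \<forall>z\<in>X. P {t\<in>{0..1}. S (mixture x t y) z}) \<longleftrightarrow>
         (\<forall>x\<in>X. \<forall>y\<in>X. \<forall>z\<in>X. P {t\<in>{0..1}. S z (mixture x t y)})"
proof -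
  have lower: "{t\<in>{0..1}. S z (mixture x t y)} =
      {t\<in>{0..1}. S (mixture (y + z) t (x + z)) (x + y)}"
    if "x \<in> X" "y \<in> X" "z \<in> X" for x y z
    using additive_on_mixture_swap[OF cone add that] by blast
  \<comment> \<open>The converse of \<open>S\<close> is additive too, and applying the swap to it
    exchanges the two sides of each comparison.\<close>
  have upper: "{t\<in>{0..1}. S (mixture x t y) z} =
      {t\<in>{0..1}. S (x + y) (mixture (y + z) t (x + z))}"
    if "x \<in> X" "y \<in> X" "z \<in> X" for x y z
    using additive_on_mixture_swap[OF cone additive_on_converse[OF add] that]
    by auto
  show ?thesis
    (is "?U \<longleftrightarrow> ?L")
  proof
    assume ?U
    \<comment> \<open>After the rewriting, the goal is \<open>?U\<close> at the points
      \<open>y + z\<close>, \<open>x + z\<close>, \<open>x + y\<close>; only their membership in the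
      cone remains to be checked.\<close>
    then show ?L
      by (intro ballI, subst lower) (auto simp only: positive_convex_cone_add[OF cone])
  next
    assume ?L
    then show ?U
      by (intro ballI, subst upper) (auto simp only: positive_convex_cone_add[OF cone])
  qed
qed

theorem theorem5:
  fixes X :: "'a::real_vector set" and R :: "'a \<Rightarrow> 'a \<Rightarrow> bool"
  assumes "positive_convex_cone X"
    and "additive_on X R"
  shows "((upper_mixture_continuous X R \<longleftrightarrow> lower_mixture_continuous X R) \<and>
          (lower_mixture_continuous X R \<longleftrightarrow> mixture_continuous X R)) \<and>
         ((upper_strict_archimedean X (asymmetric_part R) \<longleftrightarrow>
             lower_strict_archimedean X (asymmetric_part R)) \<and>
          (lower_strict_archimedean X (asymmetric_part R) \<longleftrightarrow>
             strict_archimedean X (asymmetric_part R)))"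
proof -
  have "upper_mixture_continuous X R \<longleftrightarrow> lower_mixture_continuous X R"
    unfolding upper_mixture_continuous_def lower_mixture_continuous_def
    by (rule upper_sections_iff_lower_sections[OF assms])
  moreover have "upper_strict_archimedean X (asymmetric_part R) \<longleftrightarrow>
      lower_strict_archimedean X (asymmetric_part R)"
    unfolding upper_strict_archimedean_def lower_strict_archimedean_def
    by (rule upper_sections_iff_lower_sections[OF assms(1) additive_on_asymmetric_part[OF assms(2)]])
  ultimately show ?thesis
    unfolding mixture_continuous_def strict_archimedean_def by blast
qed

end
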